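(* Let $(X,d)$ be a metric space, let $T:X\to X$ be a self-mapping, let $\varphi:X\to[0,\infty)$ be a given function, and let $\rho:=\inf\{d(Tx,x): x\in X,\ x\neq Tx\}$. Let $x_0\in X$ and suppose that $T$ is a type $2$ $\varphi_{x_0}$-contraction with the point $x_0$ and the function $\varphi$. If $\varphi(x_0)=0$ and $\varphi(x)\leq d(Tx,x)$ for all $x\in C_{x_0,\rho}$, then the circle $C_{x_0,\rho}$ is a $\varphi$-fixed circle of $T$.
   Context: Notation: $Fix(T)=\{x\in X: Tx=x\}$, $Z_\varphi=\{x\in X:\varphi(x)=0\}$, and $C_{x_0,r}=\{x\in X: d(x,x_0)=r\}$. A circle $C_{x_0,r}$ is a $\varphi$-fixed circle of $T$ if and only if $C_{x_0,r}\subseteq Fix(T)\cap Z_\varphi$. $T$ is a type $2$ $\varphi_{x_0}$-contraction if there is some $k\in(0,1)$ such that, for all $x\in X$, $d(Tx,x)>0$ implies $\max\{d(x,Tx),\varphi(Tx)\}+\varphi(x)\leq k\max\{d(x,x_0),\varphi(x)\}+\varphi(x_0)$. *)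

theory Defs
  imports "HOL-Analysis.Analysis"
begin

text \<open>
  A metric space is given by a carrier \<open>X\<close> and a distance \<open>d\<close> with \<open>Metric_space X d\<close>;
  a self-mapping of \<open>X\<close> is a function that maps \<open>X\<close> into \<open>X\<close>.
\<close>

definition Fix :: "'a set \<Rightarrow> ('a \<Rightarrow> 'a) \<Rightarrow> 'a set" where
  "Fix X T = {x \<in> X. T x = x}"

definition zero_set :: "'a set \<Rightarrow> ('a \<Rightarrow> real) \<Rightarrow> 'a set" where
  "zero_set X \<phi> = {x \<in> X. \<phi> x = 0}"

definition circle :: "'a set \<Rightarrow> ('a \<Rightarrow> 'a \<Rightarrow> real) \<Rightarrow> 'a \<Rightarrow> real \<Rightarrow> 'a set" where
  "circle X d x0 r = {x \<in> X. d x x0 = r}"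

definition phi_fixed_circle ::
    "'a set \<Rightarrow> ('a \<Rightarrow> 'a \<Rightarrow> real) \<Rightarrow> ('a \<Rightarrow> real) \<Rightarrow> ('a \<Rightarrow> 'a) \<Rightarrow> 'a \<Rightarrow> real \<Rightarrow> bool" where
  "phi_fixed_circle X d \<phi> T x0 r \<longleftrightarrow> circle X d x0 r \<subseteq> Fix X T \<inter> zero_set X \<phi>"

definition type2_phi_contraction ::
    "'a set \<Rightarrow> ('a \<Rightarrow> 'a \<Rightarrow> real) \<Rightarrow> ('a \<Rightarrow> real) \<Rightarrow> 'a \<Rightarrow> ('a \<Rightarrow> 'a) \<Rightarrow> bool" where
  "type2_phi_contraction X d \<phi> x0 T \<longleftrightarrow>
     (\<exists>k::real. 0 < k \<and> k < 1 \<and>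
       (\<forall>x\<in>X. d (T x) x > 0 \<longrightarrow>
          max (d x (T x)) (\<phi> (T x)) + \<phi> x \<le> k * max (d x x0) (\<phi> x) + \<phi> x0))"

text \<open>
  The infimum is taken over a set of reals bounded below by 0. If \<open>T\<close> is the identity on \<open>X\<close>
  that set is empty and the value is some real number about which nothing is assumed.
\<close>

definition rho :: "'a set \<Rightarrow> ('a \<Rightarrow> 'a \<Rightarrow> real) \<Rightarrow> ('a \<Rightarrow> 'a) \<Rightarrow> real" where
  "rho X d T = Inf {d (T x) x | x. x \<in> X \<and> x \<noteq> T x}"

end

theory Submission
  imports Defs
begin

text \<open>If \<open>T\<close> moves a point \<open>x\<close> of the circle, then
  \<open>d (T x) x\<close> is one of the values whose infimum is \<open>rho X d T\<close>, so it
  dominates \<open>d x x0\<close>; by hypothesis it also dominates \<open>\<phi> x\<close>. Since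
  \<open>\<phi> x0 = 0\<close>, the contraction then bounds the displacement of \<open>x\<close> by
  \<open>k < 1\<close> times itself, which is absurd for a positive number.\<close>

theorem theorem2p5:
  fixes X :: "'a set" and d :: "'a \<Rightarrow> 'a \<Rightarrow> real"
    and T :: "'a \<Rightarrow> 'a" and \<phi> :: "'a \<Rightarrow> real" and x0 :: 'a
  assumes "Metric_space X d"
    and "T \<in> X \<rightarrow> X"
    and "\<phi> \<in> X \<rightarrow> {0..}"
    and "x0 \<in> X"
    and "type2_phi_contraction X d \<phi> x0 T"
    and "\<phi> x0 = 0"
    and "\<And>x. x \<in> circle X d x0 (rho X d T) \<Longrightarrow> \<phi> x \<le> d (T x) x"
  shows "phi_fixed_circle X d \<phi> T x0 (rho X d T)"
proof -
  interpret Metric_space X d by fact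
  from assms(5) obtain k where k: "0 < k" "k < 1"
    and contr: "\<And>x. x \<in> X \<Longrightarrow> d (T x) x > 0 \<Longrightarrow>
      max (d x (T x)) (\<phi> (T x)) + \<phi> x \<le> k * max (d x x0) (\<phi> x) + \<phi> x0"
    unfolding type2_phi_contraction_def by blast
  have "T x = x \<and> \<phi> x = 0" if circ: "x \<in> circle X d x0 (rho X d T)" for x
  proof -
    from circ have x: "x \<in> X" and dx: "d x x0 = rho X d T"
      by (auto simp: circle_def)
    have Tx: "T x \<in> X" and \<phi>x: "\<phi> x \<ge> 0"
      using assms(2,3) x by auto
    have fixed: "T x = x"
    proof (rule ccontr)
      assume neq: "T x \<noteq> x"
      then have pos: "d (T x) x > 0"
        using x Tx by simp
      \<comment> \<open>The moved point \<open>x\<close> makes this set nonempty, so the unspecified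
        value of \<open>Inf\<close> on the empty set never enters.\<close>
      have "bdd_below {d (T y) y | y. y \<in> X \<and> y \<noteq> T y}"
        by (rule bdd_belowI[of _ 0]) auto
      then have "rho X d T \<le> d (T x) x"
        unfolding rho_def using x neq by (intro cInf_lower) auto
      then have "max (d x x0) (\<phi> x) \<le> d (T x) x"
        using dx assms(7)[OF circ] by simp
      then have "k * max (d x x0) (\<phi> x) \<le> k * d (T x) x"
        using k by simp
      also have "\<dots> < d (T x) x"
        using k pos by simp
      \<comment> \<open>The left side of the contraction is at least \<open>d x (T x)\<close>,
        because \<open>\<phi> x\<close> is nonnegative and the maximum dominates its first
        entry.\<close>
      finally show False
        using contr[OF x pos] assms(6) \<phi>x commute[of x "T x"] by linarith
    qed
    \<comment> \<open>At a fixed point the bound on \<open>\<phi> x\<close> becomes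
      \<open>d x x = 0\<close>.\<close>
    then show ?thesis
      using assms(7)[OF circ] \<phi>x x by simp
  qed
  then show ?thesis
    by (auto simp: phi_fixed_circle_def Fix_def zero_set_def circle_def)
qed

end
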